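(* Let $\mathbf L=(L,\vee,\wedge,{}')$ be a lattice with an involution ${}'$, and put $x\odot_S y:=y\wedge(x\vee y')$ and $x\rightarrow_S y:=x'\vee(x\wedge y)$ for $x,y\in L$. Then the following conditions are equivalent: (i) The identities $x\vee\big((x\vee y)\wedge x'\big)=x\vee y$ and $x\wedge\big((x\wedge y)\vee x'\big)=x\wedge y$ hold for all $x,y\in L$. (ii) For all $x,y,z\in L$, $x\odot_S y\leq z$ if and only if $x\leq y\rightarrow_S z$.
   Context: An involution is a unary operation ${}'$ on $L$ satisfying $x''=x$ for all $x$ (it is not assumed to be antitone, and $L$ is not assumed to be bounded). *)

theory Defs
  imports Main
begin

definition involution :: "('a \<Rightarrow> 'a) \<Rightarrow> bool"
  where "involution n \<longleftrightarrow> (\<forall>x. n (n x) = x)"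

definition sasaki_prod :: "('a::lattice \<Rightarrow> 'a) \<Rightarrow> 'a \<Rightarrow> 'a \<Rightarrow> 'a"
  where "sasaki_prod n x y = inf y (sup x (n y))"

definition sasaki_imp :: "('a::lattice \<Rightarrow> 'a) \<Rightarrow> 'a \<Rightarrow> 'a \<Rightarrow> 'a"
  where "sasaki_imp n x y = sup (n x) (inf x y)"

end

theory Submission
  imports Defs
begin

text \<open>The first identity at \<open>n y\<close> is the unit \<open>x \<le> y \<rightarrow> (x \<odot> y)\<close> of the adjunction, and the second
  identity at \<open>y\<close> is its counit \<open>(y \<rightarrow> z) \<odot> y \<le> z\<close>; since both operations are monotone,
  unit and counit together amount to adjointness.\<close>

theorem theorem7p2:
  fixes n :: "'a::lattice \<Rightarrow> 'a"
  assumes "involution n"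
  shows "(\<forall>x y. sup x (inf (sup x y) (n x)) = sup x y \<and> inf x (sup (inf x y) (n x)) = inf x y)
     \<longleftrightarrow> (\<forall>x y z. sasaki_prod n x y \<le> z \<longleftrightarrow> x \<le> sasaki_imp n y z)"
    (is "?identities \<longleftrightarrow> ?adjoint")
proof
  have nn: "n (n x) = x" for x
    using assms by (simp add: involution_def)
  {
    assume ids: ?identities
    show ?adjoint
    proof (intro allI iffI)
      fix x y z
      assume le: "sasaki_prod n x y \<le> z"
      have "x \<le> sup (n y) x"
        by simp
      also have "\<dots> = sup (n y) (inf (sup (n y) x) y)"
        using ids[rule_format, of "n y" x] by (simp add: nn)
      \<comment> \<open>Up to commutativity the second joinand is \<open>sasaki_prod n x y\<close>,
        so it lies below both \<open>y\<close> and \<open>z\<close>.\<close>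
      also have "\<dots> \<le> sasaki_imp n y z"
        using le unfolding sasaki_prod_def sasaki_imp_def
        by (intro sup_mono order_refl) (simp add: inf_commute sup_commute)
      finally show "x \<le> sasaki_imp n y z" .
    next
      fix x y z
      assume "x \<le> sasaki_imp n y z"
      then have "sasaki_prod n x y \<le> inf y (sup (inf y z) (n y))"
        unfolding sasaki_prod_def sasaki_imp_def
        by (intro inf_mono order_refl) (simp add: sup_commute)
      also have "\<dots> \<le> z"
        using ids by simp
      finally show "sasaki_prod n x y \<le> z" .
    qed
  next
    assume adj: ?adjoint
    show ?identities
    proof (intro allI conjI)
      fix x y
      \<comment> \<open>Adjointness applied to reflexivity of \<le>; the argument \<open>n x\<close>
        makes \<open>n (n x)\<close> collapse to \<open>x\<close>.\<close>
      have "y \<le> sasaki_imp n (n x) (sasaki_prod n y (n x))"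
        using adj by blast
      then have "y \<le> sup x (inf (sup x y) (n x))"
        by (simp add: sasaki_imp_def sasaki_prod_def nn inf_commute sup_commute)
      \<comment> \<open>Only the bound on \<open>y\<close> needed adjointness; the reverse
        inequality holds in every lattice.\<close>
      then show "sup x (inf (sup x y) (n x)) = sup x y"
        by (intro antisym) (auto intro: le_infI1)
      \<comment> \<open>Reflexivity again, now read from right to left through the
        adjunction.\<close>
      have "sasaki_prod n (sasaki_imp n x y) x \<le> y"
        using adj by blast
      then have "inf x (sup (inf x y) (n x)) \<le> y"
        by (simp add: sasaki_imp_def sasaki_prod_def sup_commute)
      then show "inf x (sup (inf x y) (n x)) = inf x y"
        by (intro antisym) (auto intro: le_supI1)
    qed
  }
qed

end
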